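(* Let $\mathfrak B$ be a Banach space and $(A,f)\in C(\mathbb R,[\mathfrak B])\times C(\mathbb R,\mathfrak B)$. Assume that $(A,f)$ is Lagrange stable and that the linear equation $x'=A(t)x$ has an exponential trichotomy on $\mathbb R$. Then: (1) the equation $x'=A(t)x+f(t)$ has at least one two-sided remotely compatible solution $\varphi$ defined on $\mathbb R$, i.e. $\mathfrak L_{(A,f)}\subseteq \mathfrak L_{\varphi}$; (2) the solution $\varphi$ is given by $\varphi(t)=\int_{-\infty}^{+\infty}G_A(t,\tau)f(\tau)\,d\tau$ ($t\in\mathbb R$), where $G_A$ is the Green function associated with the trichotomy; (3) every solution of $x'=A(t)x+f(t)$ that is bounded on $\mathbb R$ is two-sided remotely compatible.
   Context: $\mathfrak B$ is a real or complex Banach space with norm $|\cdot|$; $[\mathfrak B]$ is the Banach space of bounded linear operators on $\mathfrak B$ with the operator norm. For a metric space $E$, $C(\mathbb R,E)$ carries the topology of uniform convergence on compact subsets of $\mathbb R$, and $g^h(t):=g(t+h)$. A function $g\in C(\mathbb R,E)$ is Lagrange stable if $\{g^h: h\in\mathbb R\}$ is precompact in $C(\mathbb R,E)$; the pair $(A,f)$ is regarded as an element of $C(\mathbb R,[\mathfrak B]\times\mathfrak B)$. For $g\in C(\mathbb R,E)$ let $\mathfrak L_g^{\pm\infty}$ be the set of all sequences $\{t_n\}\subset\mathbb R$ such that $t_n\to\pm\infty$ and $\{g^{t_n}\}$ converges in $C(\mathbb R,E)$, and $\mathfrak L_g:=\mathfrak L_g^{-\infty}\cup\mathfrak L_g^{+\infty}$.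 A solution $\varphi\in C(\mathbb R,\mathfrak B)$ of $x'=A(t)x+f(t)$ is two-sided remotely compatible if $\mathfrak L_{(A,f)}\subseteq\mathfrak L_\varphi$. $U(t,A)$ denotes the Cauchy operator of $x'=A(t)x$ (so $U(0,A)=I$ and $t\mapsto U(t,A)x$ is the solution with value $x$ at $t=0$). The equation $x'=A(t)x$ has an exponential trichotomy on $\mathbb R$ if there are bounded linear projections $P,Q$ on $\mathfrak B$ with $PQ=QP$, $P+Q-PQ=I$, and constants $\mathcal N\ge 1$, $\nu>0$ such that $\|U(t,A)PU^{-1}(\tau,A)\|\le\mathcal N e^{-\nu(t-\tau)}$ for $0\le\tau\le t$; $\|U(t,A)(I-P)U^{-1}(\tau,A)\|\le\mathcal N e^{-\nu(\tau-t)}$ for $t\le\tau$, $\tau\ge0$; $\|U(t,A)QU^{-1}(\tau,A)\|\le\mathcal N e^{-\nu(\tau-t)}$ for $t\le\tau\le0$; $\|U(t,A)(I-Q)U^{-1}(\tau,A)\|\le\mathcal N e^{-\nu(t-\tau)}$ for $\tau\le t$, $\tau\le0$. The associated Green function is: $G_A(t,\tau)=U(t,A)PU^{-1}(\tau,A)$ if $0\le\tau<t$; $G_A(t,\tau)=-U(t,A)(I-P)U^{-1}(\tau,A)$ if $t\le\tau$, $\tau\ge0$; $G_A(t,\tau)=-U(t,A)QU^{-1}(\tau,A)$ if $t\le\tau\le0$; $G_A(t,\tau)=U(t,A)(I-Q)U^{-1}(\tau,A)$ if $\tau\le t$, $\tau\le0$ (the cases overlap only for $\tau=0$ or $\tau=t$,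 which does not affect the integral). *)

theory Defs
  imports "HOL-Analysis.Analysis"
begin

text \<open>
  The Banach space is a type \<open>'a :: banach\<close>, i.e. a real Banach space.  A complex Banach space is
  covered by restriction of scalars: the norm, the derivatives, the Cauchy operator and the
  convergence notions are unchanged, and the complex-linear bounded operators form a closed
  subspace, with the same norm, of the real-linear ones \<open>'a \<Rightarrow>\<^sub>L 'a\<close>.
\<close>

section \<open>The space of continuous functions on the line\<close>

definition loc_unif_topology :: "(real \<Rightarrow> 'e::metric_space) topology" where
  "loc_unif_topology = topology (\<lambda>V.
     V \<subseteq> {g. continuous_on UNIV g} \<and>
     (\<forall>g\<in>V. \<exists>K \<epsilon>. compact K \<and> 0 < \<epsilon> \<and>
        {h. continuous_on UNIV h \<and> (\<forall>t\<in>K. dist (h t) (g t) < \<epsilon>)} \<subseteq> V))"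

lemma openin_loc_unif_topology:
  "openin loc_unif_topology V \<longleftrightarrow>
     V \<subseteq> {g :: real \<Rightarrow> 'e::metric_space. continuous_on UNIV g} \<and>
     (\<forall>g\<in>V. \<exists>K \<epsilon>. compact K \<and> 0 < \<epsilon> \<and>
        {h. continuous_on UNIV h \<and> (\<forall>t\<in>K. dist (h t) (g t) < \<epsilon>)} \<subseteq> V)"
proof -
  define N where "N = (\<lambda>K \<epsilon> (g :: real \<Rightarrow> 'e).
     {h. continuous_on UNIV h \<and> (\<forall>t\<in>K. dist (h t) (g t) < \<epsilon>)})"
  define P where "P = (\<lambda>V. V \<subseteq> {g :: real \<Rightarrow> 'e. continuous_on UNIV g} \<and>
     (\<forall>g\<in>V. \<exists>K \<epsilon>. compact K \<and> 0 < \<epsilon> \<and> N K \<epsilon> g \<subseteq> V))"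
  have "istopology P"
    unfolding istopology_def
  proof (intro conjI allI impI)
    fix S T assume S: "P S" and T: "P T"
    show "P (S \<inter> T)"
      unfolding P_def
    proof (intro conjI ballI)
      show "S \<inter> T \<subseteq> {g. continuous_on UNIV g}" using S unfolding P_def by blast
      fix g assume "g \<in> S \<inter> T"
      then obtain K1 e1 K2 e2 where *: "compact K1" "0 < e1" "N K1 e1 g \<subseteq> S"
        "compact K2" "0 < e2" "N K2 e2 g \<subseteq> T"
        using S T unfolding P_def by (meson IntE)
      have "N (K1 \<union> K2) (min e1 e2) g \<subseteq> N K1 e1 g \<inter> N K2 e2 g"
        unfolding N_def by auto
      with * show "\<exists>K \<epsilon>. compact K \<and> 0 < \<epsilon> \<and> N K \<epsilon> g \<subseteq> S \<inter> T"
        by (intro exI[of _ "K1 \<union> K2"] exI[of _ "min e1 e2"]) (auto simp: compact_Un)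
    qed
  next
    fix \<K> assume "\<forall>V\<in>\<K>. P V"
    then show "P (\<Union>\<K>)" unfolding P_def by (smt (verit) Sup_le_iff Union_iff subset_iff)
  qed
  then have "openin (topology P) = P" by (rule topology_inverse')
  then show ?thesis by (simp add: loc_unif_topology_def P_def N_def)
qed

lemma topspace_loc_unif_topology:
  "topspace loc_unif_topology = {g :: real \<Rightarrow> 'e::metric_space. continuous_on UNIV g}"
proof -
  have "openin loc_unif_topology {g :: real \<Rightarrow> 'e. continuous_on UNIV g}"
    unfolding openin_loc_unif_topology by (auto intro!: exI[of _ "{}"] exI[of _ 1])
  moreover have "topspace loc_unif_topology \<subseteq> {g :: real \<Rightarrow> 'e. continuous_on UNIV g}"
    using openin_loc_unif_topology openin_topspace by blast
  ultimately show ?thesis using openin_subset by blast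
qed

lemma limitin_loc_unif_topology:
  fixes g :: "real \<Rightarrow> 'e::metric_space"
  assumes "\<And>n. continuous_on UNIV (G n)"
  shows "limitin loc_unif_topology G g F \<longleftrightarrow>
           continuous_on UNIV g \<and> (\<forall>K. compact K \<longrightarrow> uniform_limit K G g F)"
proof
  assume L: "limitin loc_unif_topology G g F"
  then have g: "continuous_on UNIV g"
    by (simp add: limitin_def topspace_loc_unif_topology)
  moreover have "uniform_limit K G g F" if K: "compact K" for K
  proof (rule uniform_limitI)
    fix e :: real assume "e > 0"
    let ?W = "{h. continuous_on UNIV h \<and> (\<forall>t\<in>K. dist (h t) (g t) < e)}"
    have "openin loc_unif_topology ?W"
      unfolding openin_loc_unif_topology
    proof (intro conjI ballI)
      fix h assume h: "h \<in> ?W"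
      have "\<exists>d>0. \<forall>t\<in>K. dist (h t) (g t) + d \<le> e"
      proof (cases "K = {}")
        case False
        have "continuous_on K (\<lambda>t. dist (h t) (g t))"
          using h g by (intro continuous_on_dist) (auto intro: continuous_on_subset)
        then obtain s where s: "s \<in> K" "\<forall>t\<in>K. dist (h t) (g t) \<le> dist (h s) (g s)"
          using continuous_attains_sup[OF K False] by blast
        then show ?thesis using h
          by (intro exI[of _ "e - dist (h s) (g s)"]) auto
      qed (auto intro: exI[of _ 1])
      then obtain d where d: "d > 0" "\<forall>t\<in>K. dist (h t) (g t) + d \<le> e" by blast
      have "{k. continuous_on UNIV k \<and> (\<forall>t\<in>K. dist (k t) (h t) < d)} \<subseteq> ?W"
        using d(2) by (smt (verit) Collect_mono_iff dist_triangle)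
      with d K show "\<exists>K' \<epsilon>. compact K' \<and> 0 < \<epsilon> \<and>
        {k. continuous_on UNIV k \<and> (\<forall>t\<in>K'. dist (k t) (h t) < \<epsilon>)} \<subseteq> ?W" by blast
    qed auto
    moreover have "g \<in> ?W" using g \<open>e > 0\<close> by simp
    ultimately have "\<forall>\<^sub>F n in F. G n \<in> ?W" using L unfolding limitin_def by blast
    then show "\<forall>\<^sub>F n in F. \<forall>t\<in>K. dist (G n t) (g t) < e"
      by (rule eventually_mono) auto
  qed
  ultimately show "continuous_on UNIV g \<and> (\<forall>K. compact K \<longrightarrow> uniform_limit K G g F)" by blast
next
  assume R: "continuous_on UNIV g \<and> (\<forall>K. compact K \<longrightarrow> uniform_limit K G g F)"
  show "limitin loc_unif_topology G g F"
    unfolding limitin_def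
  proof (intro conjI allI impI)
    show "g \<in> topspace loc_unif_topology" using R by (simp add: topspace_loc_unif_topology)
    fix V assume "openin loc_unif_topology V \<and> g \<in> V"
    then obtain K e where K: "compact K" "0 < e"
      "{h. continuous_on UNIV h \<and> (\<forall>t\<in>K. dist (h t) (g t) < e)} \<subseteq> V"
      unfolding openin_loc_unif_topology by blast
    have "\<forall>\<^sub>F n in F. \<forall>t\<in>K. dist (G n t) (g t) < e"
      using R K by (auto dest: uniform_limitD)
    then show "\<forall>\<^sub>F n in F. G n \<in> V"
      by (rule eventually_mono) (use K(3) assms in blast)
  qed
qed

definition shift :: "real \<Rightarrow> (real \<Rightarrow> 'e) \<Rightarrow> real \<Rightarrow> 'e" where
  "shift h g = (\<lambda>t. g (t + h))"

definition lagrange_stable :: "(real \<Rightarrow> 'e::metric_space) \<Rightarrow> bool" where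
  "lagrange_stable g \<longleftrightarrow> continuous_on UNIV g \<and>
     compactin loc_unif_topology (loc_unif_topology closure_of (range (\<lambda>h. shift h g)))"

definition shifts_converge :: "(real \<Rightarrow> 'e::metric_space) \<Rightarrow> (nat \<Rightarrow> real) \<Rightarrow> bool" where
  "shifts_converge g t \<longleftrightarrow> (\<exists>h. limitin loc_unif_topology (\<lambda>n. shift (t n) g) h sequentially)"

definition L_plus_inf :: "(real \<Rightarrow> 'e::metric_space) \<Rightarrow> (nat \<Rightarrow> real) set" where
  "L_plus_inf g = {t. filterlim t at_top sequentially \<and> shifts_converge g t}"

definition L_minus_inf :: "(real \<Rightarrow> 'e::metric_space) \<Rightarrow> (nat \<Rightarrow> real) set" where
  "L_minus_inf g = {t. filterlim t at_bot sequentially \<and> shifts_converge g t}"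

definition L_inf :: "(real \<Rightarrow> 'e::metric_space) \<Rightarrow> (nat \<Rightarrow> real) set" where
  "L_inf g = L_minus_inf g \<union> L_plus_inf g"

section \<open>Linear differential equations\<close>

definition is_solution ::
  "(real \<Rightarrow> 'a::banach \<Rightarrow>\<^sub>L 'a) \<Rightarrow> (real \<Rightarrow> 'a) \<Rightarrow> (real \<Rightarrow> 'a) \<Rightarrow> bool" where
  "is_solution A f \<phi> \<longleftrightarrow>
     (\<forall>t. (\<phi> has_vector_derivative (blinfun_apply (A t) (\<phi> t) + f t)) (at t))"

definition two_sided_remotely_compatible ::
  "(real \<Rightarrow> 'a::banach \<Rightarrow>\<^sub>L 'a) \<Rightarrow> (real \<Rightarrow> 'a) \<Rightarrow> (real \<Rightarrow> 'a) \<Rightarrow> bool" where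
  "two_sided_remotely_compatible A f \<phi> \<longleftrightarrow> L_inf (\<lambda>t. (A t, f t)) \<subseteq> L_inf \<phi>"

text \<open>
  For continuous \<open>A\<close> the Cauchy operator exists, is unique, and all its values are invertible;
  outside that case the following two descriptions are unspecified.
\<close>

definition cauchy_op :: "(real \<Rightarrow> 'a::banach \<Rightarrow>\<^sub>L 'a) \<Rightarrow> real \<Rightarrow> 'a \<Rightarrow>\<^sub>L 'a" where
  "cauchy_op A = (THE U. U 0 = id_blinfun \<and>
     (\<forall>x. is_solution A (\<lambda>_. 0) (\<lambda>t. blinfun_apply (U t) x)))"

definition blinfun_inverse :: "('a::real_normed_vector \<Rightarrow>\<^sub>L 'a) \<Rightarrow> 'a \<Rightarrow>\<^sub>L 'a" where
  "blinfun_inverse T = (THE S. S o\<^sub>L T = id_blinfun \<and> T o\<^sub>L S = id_blinfun)"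

definition conj_op ::
  "(real \<Rightarrow> 'a::banach \<Rightarrow>\<^sub>L 'a) \<Rightarrow> ('a \<Rightarrow>\<^sub>L 'a) \<Rightarrow> real \<Rightarrow> real \<Rightarrow> 'a \<Rightarrow>\<^sub>L 'a" where
  "conj_op A R t \<tau> = cauchy_op A t o\<^sub>L R o\<^sub>L blinfun_inverse (cauchy_op A \<tau>)"

definition exponential_trichotomy ::
  "(real \<Rightarrow> 'a::banach \<Rightarrow>\<^sub>L 'a) \<Rightarrow> ('a \<Rightarrow>\<^sub>L 'a) \<Rightarrow> ('a \<Rightarrow>\<^sub>L 'a) \<Rightarrow> bool" where
  "exponential_trichotomy A P Q \<longleftrightarrow>
     P o\<^sub>L P = P \<and> Q o\<^sub>L Q = Q \<and> P o\<^sub>L Q = Q o\<^sub>L P \<and> P + Q - (P o\<^sub>L Q) = id_blinfun \<and>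
     (\<exists>N \<nu>. 1 \<le> N \<and> 0 < \<nu> \<and>
        (\<forall>t \<tau>. 0 \<le> \<tau> \<and> \<tau> \<le> t \<longrightarrow>
           norm (conj_op A P t \<tau>) \<le> N * exp (- \<nu> * (t - \<tau>))) \<and>
        (\<forall>t \<tau>. t \<le> \<tau> \<and> 0 \<le> \<tau> \<longrightarrow>
           norm (conj_op A (id_blinfun - P) t \<tau>) \<le> N * exp (- \<nu> * (\<tau> - t))) \<and>
        (\<forall>t \<tau>. t \<le> \<tau> \<and> \<tau> \<le> 0 \<longrightarrow>
           norm (conj_op A Q t \<tau>) \<le> N * exp (- \<nu> * (\<tau> - t))) \<and>
        (\<forall>t \<tau>. \<tau> \<le> t \<and> \<tau> \<le> 0 \<longrightarrow>
           norm (conj_op A (id_blinfun - Q) t \<tau>) \<le> N * exp (- \<nu> * (t - \<tau>))))"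

text \<open>
  The four cases of the Green function overlap only for \<open>\<tau> = 0\<close> or \<open>\<tau> = t\<close>; there the first
  applicable one is taken, which does not affect integrals over \<open>\<tau>\<close>.
\<close>

definition green ::
  "(real \<Rightarrow> 'a::banach \<Rightarrow>\<^sub>L 'a) \<Rightarrow> ('a \<Rightarrow>\<^sub>L 'a) \<Rightarrow> ('a \<Rightarrow>\<^sub>L 'a) \<Rightarrow> real \<Rightarrow> real \<Rightarrow> 'a \<Rightarrow>\<^sub>L 'a" where
  "green A P Q t \<tau> =
     (if 0 \<le> \<tau> \<and> \<tau> < t then conj_op A P t \<tau>
      else if t \<le> \<tau> \<and> 0 \<le> \<tau> then - conj_op A (id_blinfun - P) t \<tau>
      else if t \<le> \<tau> \<and> \<tau> \<le> 0 then - conj_op A Q t \<tau>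
      else conj_op A (id_blinfun - Q) t \<tau>)"

text \<open>
  Absolutely convergent integral over the line.  The library's Bochner integral is restricted to
  separable spaces, so the gauge integral is used, together with integrability of the norm.
\<close>

definition has_abs_integral_line :: "(real \<Rightarrow> 'a::banach) \<Rightarrow> 'a \<Rightarrow> bool" where
  "has_abs_integral_line g y \<longleftrightarrow>
     (g has_integral y) UNIV \<and> (\<lambda>\<tau>. norm (g \<tau>)) integrable_on UNIV"

end

theory Submission
  imports Defs
begin

text \<open>
  With \<open>U\<close> the Cauchy operator, \<open>V = U\<^sup>-\<^sup>1\<close> and \<open>F = V f\<close>, the Green kernel satisfies
  \<open>G(t, \<tau>) f(\<tau>) = U(t) (G(0, \<tau>) f(\<tau>) \<plusminus> 1(\<tau>) F(\<tau>))\<close>, where \<open>1\<close> is the indicator of the interval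
  between \<open>0\<close> and \<open>t\<close>.  Hence its integral is \<open>U(t)\<close> applied to a constant plus the primitive of
  \<open>F\<close>, which is a solution by variation of constants; it is bounded because the kernel decays like
  \<open>exp (- \<nu> \<bar>t - \<tau>\<bar>)\<close>.

  Let \<open>\<psi>\<close> be a bounded solution and let the translates of \<open>(A, f)\<close> along \<open>t\<^sub>n \<rightarrow> \<plusminus>\<infinity>\<close> converge.  The
  difference of the translates of \<open>\<psi>\<close> by \<open>t\<^sub>n\<close> and \<open>t\<^sub>m\<close> solves a linear equation whose
  inhomogeneity is small on long windows.  These windows eventually lie in one half-line, where the
  trichotomy is a dichotomy, so the difference is small: the translates form a Cauchy sequence and no
  limit equation has to be studied.
\<close>

section \<open>Linear equations in a Banach space\<close>

lemmas has_vector_derivative_blinfun_apply =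
  bounded_bilinear.has_vector_derivative[OF bounded_bilinear_blinfun_apply]

lemmas has_vector_derivative_blinfun_compose =
  bounded_bilinear.has_vector_derivative[OF bounded_bilinear_blinfun_compose]

lemma has_vector_derivative_reflect:
  assumes "(f has_vector_derivative D) (at (- t))"
  shows "((\<lambda>s. f (- s)) has_vector_derivative - D) (at t)"
proof -
  have "((\<lambda>s::real. - s) has_vector_derivative - 1) (at t)"
    by (auto intro!: derivative_eq_intros)
  from vector_diff_chain_at[OF this assms] show ?thesis by (simp add: o_def)
qed

lemma continuous_on_UNIV_of_has_vector_derivative:
  assumes "\<And>t. (f has_vector_derivative f' t) (at t)"
  shows "continuous_on S f"
  using assms continuous_at_imp_continuous_on has_vector_derivative_continuous by blast

text \<open>The integral from \<open>0\<close> to \<open>t\<close>, oriented: one of the two gauge integrals is always over a set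
  with at most one point.\<close>

definition primitive :: "(real \<Rightarrow> 'a::banach) \<Rightarrow> real \<Rightarrow> 'a" where
  "primitive g t = integral {0..t} g - integral {t..0} g"

lemma primitive_0 [simp]: "primitive g 0 = 0"
  by (simp add: primitive_def)

lemma has_vector_derivative_primitive:
  assumes g: "continuous_on UNIV g"
  shows "(primitive g has_vector_derivative g t) (at t)"
proof -
  \<comment> \<open>On \<open>{- T<..<T}\<close> the primitive differs by a constant from the
    integral starting at \<open>- T\<close>, so the sign convention disappears and the fundamental
    theorem applies.\<close>
  define T where "T = \<bar>t\<bar> + 1"
  have int: "g integrable_on {a..b}" for a b
    using g continuous_on_subset integrable_continuous_real by blast
  have eq: "primitive g s = integral {- T..s} g - integral {- T..0} g" if "s \<in> {- T<..<T}" for s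
  proof (cases "s \<ge> 0")
    case True
    then show ?thesis
      using Henstock_Kurzweil_Integration.integral_combine[of "- T" 0 s g] int that
      by (cases "s = 0") (auto simp: primitive_def algebra_simps)
  next
    case False
    then show ?thesis
      using Henstock_Kurzweil_Integration.integral_combine[of "- T" s 0 g] int that
      by (auto simp: primitive_def algebra_simps)
  qed
  have t: "t \<in> {- T<..<T}" by (auto simp: T_def)
  have "((\<lambda>u. integral {- T..u} g) has_vector_derivative g t) (at t within {- T..T})"
    by (rule integral_has_vector_derivative) (use t g continuous_on_subset in auto)
  then have "((\<lambda>u. integral {- T..u} g) has_vector_derivative g t) (at t)"
    using t by (simp add: at_within_Icc_at)
  then have "((\<lambda>u. integral {- T..u} g - integral {- T..0} g) has_vector_derivative g t) (at t)"
    by (simp add: has_vector_derivative_diff_const)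
  then show ?thesis
    by (rule has_vector_derivative_transform_within_open[OF _ open_greaterThanLessThan t])
      (simp add: eq)
qed

text \<open>Each integration raises the power by one and divides by the new exponent; iterated, this
  yields the factorials that make the Peano--Baker series converge.\<close>

lemma norm_le_power_integral_pos:
  fixes h :: "real \<Rightarrow> 'a::banach"
  assumes h: "\<And>s. (h has_vector_derivative h' s) (at s)" "h 0 = 0" and t: "0 \<le> t"
    and bd: "\<And>s. 0 \<le> s \<Longrightarrow> s \<le> t \<Longrightarrow> norm (h' s) \<le> C * s ^ n"
  shows "norm (h t) \<le> C * t ^ Suc n / real (Suc n)"
proof (cases "t = 0")
  case False
  have "norm (h t - h 0) \<le> C * t ^ Suc n / real (Suc n) - C * 0 ^ Suc n / real (Suc n)"
  proof (rule differentiable_bound_general[where \<phi>' = "\<lambda>s. C * s ^ n" and f' = h'])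
    show "((\<lambda>s. C * s ^ Suc n / real (Suc n)) has_vector_derivative C * s ^ n) (at s)" for s
      using DERIV_cdivide[OF DERIV_cmult[OF DERIV_pow[of "Suc n" s]], of C "real (Suc n)"]
      unfolding has_real_derivative_iff_has_vector_derivative by (simp del: of_nat_Suc)
    show "continuous_on {0..t} h"
      using h(1) by (rule continuous_on_UNIV_of_has_vector_derivative)
  qed (use h t False bd in \<open>auto intro!: continuous_intros simp del: of_nat_Suc\<close>)
  then show ?thesis using h(2) by simp
qed (use h in simp)

lemma norm_le_power_integral:
  fixes h :: "real \<Rightarrow> 'a::banach"
  assumes h: "\<And>s. (h has_vector_derivative h' s) (at s)" "h 0 = 0"
    and bd: "\<And>s. \<bar>s\<bar> \<le> \<bar>t\<bar> \<Longrightarrow> norm (h' s) \<le> C * \<bar>s\<bar> ^ n"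
  shows "norm (h t) \<le> C * \<bar>t\<bar> ^ Suc n / real (Suc n)"
proof (cases "t \<ge> 0")
  case True
  have "norm (h' s) \<le> C * s ^ n" if "0 \<le> s" "s \<le> t" for s
    using bd[of s] that by simp
  from norm_le_power_integral_pos[OF h True this] True show ?thesis by simp
next
  case False
  have "norm (h (- (- t))) \<le> C * (- t) ^ Suc n / real (Suc n)"
  proof (rule norm_le_power_integral_pos[where h = "\<lambda>s. h (- s)" and h' = "\<lambda>s. - h' (- s)"])
    show "((\<lambda>s. h (- s)) has_vector_derivative - h' (- s)) (at s)" for s
      by (rule has_vector_derivative_reflect) (rule h)
    show "norm (- h' (- s)) \<le> C * s ^ n" if "0 \<le> s" "s \<le> - t" for s
      using bd[of "- s"] that by simp
  qed (use h False in auto)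
  then show ?thesis using False by simp
qed

text \<open>The solution is the Peano--Baker series.\<close>

lemma linear_ode_solution_exists:
  fixes L :: "real \<Rightarrow> 'e::banach \<Rightarrow>\<^sub>L 'e"
  assumes L: "continuous_on UNIV L"
  obtains X where "X 0 = x0" "\<And>t. (X has_vector_derivative L t (X t)) (at t)"
proof -
  \<comment> \<open>\<open>X n\<close> is the n-fold iterated integral, that is the n-th term of the
    series and not its n-th partial sum.\<close>
  define X where "X = rec_nat (\<lambda>_. x0) (\<lambda>_ Y. primitive (\<lambda>t. blinfun_apply (L t) (Y t)))"
  have X0: "X 0 = (\<lambda>_. x0)" and XS: "X (Suc n) = primitive (\<lambda>t. L t (X n t))" for n
    by (simp_all add: X_def)
  have contX: "continuous_on UNIV (X n)" for n
  proof (induction n)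
    case (Suc n)
    show ?case unfolding XS
      by (rule continuous_on_UNIV_of_has_vector_derivative[OF has_vector_derivative_primitive])
        (intro continuous_intros L Suc)
  qed (simp add: X0)
  have derX: "(X (Suc n) has_vector_derivative L t (X n t)) (at t)" for n t
    unfolding XS by (rule has_vector_derivative_primitive) (intro continuous_intros L contX)
  define Y where "Y = (\<lambda>t. \<Sum>n. X n t)"
  \<comment> \<open>The derivative of a term is \<open>L t\<close> applied to the preceding term.
    This index shift is why the differentiated series sums to \<open>L t (Y t)\<close>.\<close>
  define d where "d = (\<lambda>n t. case n of 0 \<Rightarrow> 0 | Suc m \<Rightarrow> blinfun_apply (L t) (X m t))"
  have derXd: "(X n has_vector_derivative d n t) (at t)" for n t
    by (cases n) (auto simp: d_def X0 derX)
  have X_at_0: "X n 0 = (if n = 0 then x0 else 0)" for n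
    by (cases n) (auto simp: X0 XS)
  have "(Y has_vector_derivative L t (Y t)) (at t)" for t
  proof -
    \<comment> \<open>Termwise differentiation takes place on a bounded open interval, where
      \<open>L\<close> is bounded. It contains \<open>0\<close>, where only the term with index 0
      can be nonzero and convergence is trivial.\<close>
    define T where "T = \<bar>t\<bar> + 1"
    define S where "S = {- T<..<T}"
    have tS: "t \<in> S" "0 \<in> S" by (auto simp: S_def T_def)
    have "bounded (L ` {- T..T})"
      by (intro compact_imp_bounded compact_continuous_image) (use L continuous_on_subset in auto)
    then obtain a where "0 < a" and a: "\<And>s. \<bar>s\<bar> \<le> T \<Longrightarrow> norm (L s) \<le> a"
      by (force simp: bounded_pos)
    \<comment> \<open>The majorants are the terms of the series of
      \<open>norm x0 * exp (a * T)\<close>; \<open>M'\<close> below is the shifted version for the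
      derivatives.\<close>
    define M where "M = (\<lambda>n. norm x0 * (inverse (fact n) * (a * T) ^ n))"
    have bdX: "norm (X n s) \<le> norm x0 * a ^ n * \<bar>s\<bar> ^ n / fact n" if "\<bar>s\<bar> \<le> T" for n s
      using that
    proof (induction n arbitrary: s)
      case (Suc n)
      have "norm (X (Suc n) s) \<le> (norm x0 * a ^ Suc n / fact n) * \<bar>s\<bar> ^ Suc n / real (Suc n)"
      proof (rule norm_le_power_integral[OF derX])
        fix r assume r: "\<bar>r\<bar> \<le> \<bar>s\<bar>"
        have "norm (L r (X n r)) \<le> norm (L r) * norm (X n r)" by (rule norm_blinfun)
        also have "\<dots> \<le> a * (norm x0 * a ^ n * \<bar>r\<bar> ^ n / fact n)"
          using r Suc a \<open>0 < a\<close> by (intro mult_mono) auto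
        finally show "norm (L r (X n r)) \<le> norm x0 * a ^ Suc n / fact n * \<bar>r\<bar> ^ n"
          by (simp add: mult_ac)
      qed (simp add: X_at_0)
      then show ?case by (simp add: field_simps)
    qed (simp add: X0)
    have bdM: "norm (X n s) \<le> M n" if "\<bar>s\<bar> \<le> T" for n s
    proof -
      have "norm (X n s) \<le> norm x0 * a ^ n * \<bar>s\<bar> ^ n / fact n" using that by (rule bdX)
      also have "\<dots> \<le> norm x0 * a ^ n * T ^ n / fact n"
        using that \<open>0 < a\<close> by (intro divide_right_mono mult_left_mono power_mono) auto
      finally show ?thesis by (simp add: M_def power_mult_distrib field_simps)
    qed
    have sumM: "summable M"
      unfolding M_def by (intro summable_mult summable_exp)
    have sumX: "summable (\<lambda>n. X n s)" if "\<bar>s\<bar> \<le> T" for s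
      using bdM[OF that] sumM by (intro summable_comparison_test[of "\<lambda>n. X n s" M]) auto
    define M' where "M' = (\<lambda>n. case n of 0 \<Rightarrow> 0 | Suc m \<Rightarrow> a * M m)"
    have sumM': "summable M'"
      using summable_Suc_iff[of M'] sumM by (simp add: M'_def summable_mult)
    have bdd: "norm (d n s) \<le> M' n" if "s \<in> S" for n s
    proof (cases n)
      case (Suc m)
      have "norm (L s (X m s)) \<le> norm (L s) * norm (X m s)" by (rule norm_blinfun)
      also have "\<dots> \<le> a * M m"
        using that a bdM \<open>0 < a\<close> by (intro mult_mono) (auto simp: S_def)
      finally show ?thesis by (simp add: d_def M'_def Suc)
    qed (simp add: d_def M'_def)
    have d_sum: "(\<Sum>n. d n s) = L s (Y s)" if "\<bar>s\<bar> \<le> T" for s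
    proof -
      have "(\<lambda>n. d (Suc n) s) sums L s (Y s)"
        unfolding d_def Y_def using sumX[OF that]
        by (simp add: bounded_linear.sums[OF blinfun.bounded_linear_right] summable_sums)
      then have "(\<lambda>n. d n s) sums (L s (Y s) + d 0 s)" by (rule sums_Suc)
      then show ?thesis by (simp add: d_def sums_iff)
    qed
    have "uniform_limit S (\<lambda>n s. \<Sum>i<n. d i s) (\<lambda>s. \<Sum>i. d i s) sequentially"
      by (rule Weierstrass_m_test[OF bdd sumM'])
    then have ul: "\<forall>\<^sub>F n in sequentially. \<forall>s\<in>S. norm ((\<Sum>i<n. d i s) - (\<Sum>i. d i s)) < e"
      if "e > 0" for e
      using that unfolding uniform_limit_iff dist_norm by blast
    have "\<exists>g. \<forall>s\<in>S. (\<lambda>n. X n s) sums g s \<and>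
        (g has_derivative (\<lambda>h. h *\<^sub>R (\<Sum>i. d i s))) (at s within S)"
    proof (rule has_derivative_series[where f' = "\<lambda>n s h. h *\<^sub>R d n s"])
      show "(X n has_derivative (\<lambda>h. h *\<^sub>R d n s)) (at s within S)" for n s
        using derXd[of n s] has_vector_derivative_at_within has_vector_derivative_def by blast
      show "\<forall>\<^sub>F n in sequentially. \<forall>s\<in>S. \<forall>h.
          norm ((\<Sum>i<n. h *\<^sub>R d i s) - h *\<^sub>R (\<Sum>i. d i s)) \<le> e * norm h" if "e > 0" for e
        using ul[OF that]
      proof (rule eventually_mono, intro ballI allI)
        fix n s h assume "\<forall>s\<in>S. norm ((\<Sum>i<n. d i s) - (\<Sum>i. d i s)) < e" "s \<in> S"
        then have "norm ((\<Sum>i<n. d i s) - (\<Sum>i. d i s)) \<le> e" by auto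
        then have "\<bar>h\<bar> * norm ((\<Sum>i<n. d i s) - (\<Sum>i. d i s)) \<le> \<bar>h\<bar> * e"
          by (intro mult_left_mono) auto
        then show "norm ((\<Sum>i<n. h *\<^sub>R d i s) - h *\<^sub>R (\<Sum>i. d i s)) \<le> e * norm h"
          by (simp flip: scaleR_sum_right scaleR_diff_right) (simp add: mult.commute)
      qed
      show "(\<lambda>n. X n 0) sums x0" using sums_single[of 0 "\<lambda>_. x0"] by (simp add: X_at_0)
    qed (use tS in \<open>auto simp: S_def\<close>)
    then obtain g where g: "\<And>s. s \<in> S \<Longrightarrow> (\<lambda>n. X n s) sums g s"
      "\<And>s. s \<in> S \<Longrightarrow> (g has_vector_derivative (\<Sum>i. d i s)) (at s within S)"
      unfolding has_vector_derivative_def by blast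
    have "open S" by (simp add: S_def)
    have "(g has_vector_derivative L t (Y t)) (at t)"
      using g(2)[OF tS(1)] d_sum[of t] at_within_open[OF tS(1) \<open>open S\<close>] by (simp add: T_def)
    then show ?thesis
      by (rule has_vector_derivative_transform_within_open[OF _ \<open>open S\<close> tS(1)])
        (use g(1) in \<open>auto simp: Y_def sums_iff\<close>)
  qed
  moreover have "Y 0 = x0"
    using sums_single[of 0 "\<lambda>_. x0"] by (simp add: Y_def X_at_0 sums_iff)
  ultimately show ?thesis using that by blast
qed

section \<open>Invertibility and uniqueness of the Cauchy operator\<close>

lemma blinfun_idempotent_near_id:
  fixes E :: "'a::real_normed_vector \<Rightarrow>\<^sub>L 'a"
  assumes "E o\<^sub>L E = E" "norm (id_blinfun - E) < 1"
  shows "E = id_blinfun"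
proof -
  \<comment> \<open>The complement of an idempotent is idempotent, so
    \<open>norm D \<le> norm D * norm D\<close>, and a norm below 1 must vanish. Among idempotents,
    being the identity is thus an open condition.\<close>
  define D where "D = id_blinfun - E"
  have "D o\<^sub>L D = D"
    using arg_cong[OF assms(1), of blinfun_apply]
    by (intro blinfun_eqI) (simp add: D_def blinfun.bilinear_simps fun_eq_iff)
  then have "norm D \<le> norm D * norm D"
    by (metis norm_blinfun_compose)
  moreover have "norm D * norm D < norm D * 1" if "0 < norm D"
    using assms(2) that by (intro mult_strict_left_mono) (simp_all add: D_def)
  ultimately have "norm D = 0"
    using norm_ge_zero[of D] by linarith
  then show ?thesis by (simp add: D_def)
qed

lemma constant_of_zero_derivative:
  assumes "\<And>t. (f has_vector_derivative 0) (at t)"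
  shows "f t = f (s::real)"
  using has_vector_derivative_zero_constant[of UNIV f] assms by (metis UNIV_I convex_UNIV)

text \<open>\<open>V o\<^sub>L U\<close> is constant, so \<open>U o\<^sub>L V\<close> is a continuous family of idempotents; the parameters where
  it is the identity form a clopen set.\<close>

lemma cauchy_pair_exists:
  fixes A :: "real \<Rightarrow> 'a::banach \<Rightarrow>\<^sub>L 'a"
  assumes A: "continuous_on UNIV A"
  obtains U V where "U 0 = id_blinfun" "V 0 = id_blinfun"
    "\<And>t. (U has_vector_derivative (A t o\<^sub>L U t)) (at t)"
    "\<And>t. (V has_vector_derivative - (V t o\<^sub>L A t)) (at t)"
    "\<And>t. V t o\<^sub>L U t = id_blinfun" "\<And>t. U t o\<^sub>L V t = id_blinfun"
proof -
  \<comment> \<open>\<open>U\<close> and \<open>V\<close> solve linear equations in the Banach space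
    of operators, with left multiplication by \<open>A t\<close> and negated right multiplication by
    \<open>A t\<close> as coefficients.\<close>
  define lm where "lm = (\<lambda>T::'a \<Rightarrow>\<^sub>L 'a. Blinfun (\<lambda>S::'a \<Rightarrow>\<^sub>L 'a. T o\<^sub>L S))"
  define rm where "rm = (\<lambda>T::'a \<Rightarrow>\<^sub>L 'a. Blinfun (\<lambda>S::'a \<Rightarrow>\<^sub>L 'a. - (S o\<^sub>L T)))"
  note cc = bounded_bilinear_blinfun_compose[where 'a='a and 'b='a and 'c='a]
  have lm: "blinfun_apply (lm T) S = T o\<^sub>L S" and rm: "blinfun_apply (rm T) S = - (S o\<^sub>L T)" for T S
    using bounded_bilinear.bounded_linear_right[OF cc, of T]
      bounded_linear_minus[OF bounded_bilinear.bounded_linear_left[OF cc, of T]]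
    by (simp_all add: lm_def rm_def bounded_linear_Blinfun_apply)
  have nlm: "norm (lm T - lm S) \<le> norm (T - S)" for T S
  proof (rule norm_blinfun_bound)
    fix R :: "'a \<Rightarrow>\<^sub>L 'a"
    have "blinfun_apply (lm T - lm S) R = (T - S) o\<^sub>L R"
      by (simp add: lm blinfun.diff_left bounded_bilinear.diff_left[OF cc])
    then show "norm ((lm T - lm S) R) \<le> norm (T - S) * norm R"
      by (simp add: norm_blinfun_compose)
  qed simp
  have nrm: "norm (rm T - rm S) \<le> norm (T - S)" for T S
  proof (rule norm_blinfun_bound)
    fix R :: "'a \<Rightarrow>\<^sub>L 'a"
    have "blinfun_apply (rm T - rm S) R = - (R o\<^sub>L (T - S))"
      by (simp add: rm blinfun.diff_left bounded_bilinear.diff_right[OF cc])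
    then show "norm ((rm T - rm S) R) \<le> norm (T - S) * norm R"
      by (simp add: norm_blinfun_compose mult.commute[of "norm (T - S)"])
  qed simp
  have cont: "continuous_on UNIV (\<lambda>t. m (A t))"
    if "\<And>T S. norm (m T - m S) \<le> norm (T - S)" for m :: "('a \<Rightarrow>\<^sub>L 'a) \<Rightarrow> ('a \<Rightarrow>\<^sub>L 'a) \<Rightarrow>\<^sub>L ('a \<Rightarrow>\<^sub>L 'a)"
    using A that unfolding continuous_on_iff dist_norm by (meson le_less_trans)
  obtain U where U: "U 0 = id_blinfun" "\<And>t. (U has_vector_derivative (A t o\<^sub>L U t)) (at t)"
    using linear_ode_solution_exists[OF cont[of lm, OF nlm], of id_blinfun] by (auto simp: lm)
  obtain V where V: "V 0 = id_blinfun" "\<And>t. (V has_vector_derivative - (V t o\<^sub>L A t)) (at t)"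
    using linear_ode_solution_exists[OF cont[of rm, OF nrm], of id_blinfun] by (auto simp: rm)
  have "((\<lambda>t. V t o\<^sub>L U t) has_vector_derivative 0) (at t)" for t
    by (rule has_vector_derivative_eq_rhs[OF has_vector_derivative_blinfun_compose[OF V(2) U(2)]])
      (auto intro!: blinfun_eqI simp: blinfun.bilinear_simps)
  then have VU: "V t o\<^sub>L U t = id_blinfun" for t
    using constant_of_zero_derivative[of "\<lambda>t. V t o\<^sub>L U t" t 0] U(1) V(1)
    by (auto intro!: blinfun_eqI)
  \<comment> \<open>In infinite dimension a left inverse need not be a right inverse, so the other
    product needs its own argument.\<close>
  define E where "E = (\<lambda>t. U t o\<^sub>L V t)"
  have E2: "E t o\<^sub>L E t = E t" for t
    using arg_cong[OF VU[of t], of blinfun_apply]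
    by (intro blinfun_eqI) (simp add: E_def fun_eq_iff)
  have Ec: "continuous_on UNIV E"
    unfolding E_def using has_vector_derivative_blinfun_compose[OF U(2) V(2)]
    by (rule continuous_on_UNIV_of_has_vector_derivative)
  have "E t = id_blinfun \<longleftrightarrow> norm (id_blinfun - E t) < 1" for t
    using blinfun_idempotent_near_id[OF E2[of t]] by auto
  then have eq: "{t. E t = id_blinfun} = {t. norm (id_blinfun - E t) < 1}" by auto
  have "open {t. norm (id_blinfun - E t) < 1}"
    by (intro open_Collect_less continuous_intros Ec)
  moreover have "closed {t. E t = id_blinfun}"
    by (intro closed_Collect_eq continuous_intros Ec)
  ultimately have "{t. E t = id_blinfun} = {} \<or> {t. E t = id_blinfun} = UNIV"
    using eq clopen by metis
  moreover have "E 0 = id_blinfun" using U(1) V(1) by (auto simp: E_def intro!: blinfun_eqI)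
  ultimately have "E t = id_blinfun" for t by blast
  then show ?thesis using that U V VU unfolding E_def by blast
qed

text \<open>Transfers the constructed pair to the definite descriptions \<open>cauchy_op\<close> and
  \<open>blinfun_inverse\<close>, which requires uniqueness of both.\<close>

lemma cauchy_pair:
  fixes A :: "real \<Rightarrow> 'a::banach \<Rightarrow>\<^sub>L 'a"
  assumes A: "continuous_on UNIV A"
  defines "V \<equiv> \<lambda>t. blinfun_inverse (cauchy_op A t)"
  shows "(cauchy_op A has_vector_derivative (A t o\<^sub>L cauchy_op A t)) (at t)"
    and "(V has_vector_derivative - (V t o\<^sub>L A t)) (at t)"
    and "cauchy_op A t (V t x) = x"
    and "cauchy_op A 0 = id_blinfun"
proof -
  obtain U W where U0: "U 0 = id_blinfun" "W 0 = id_blinfun"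
    and dU: "\<And>t. (U has_vector_derivative (A t o\<^sub>L U t)) (at t)"
    and dW: "\<And>t. (W has_vector_derivative - (W t o\<^sub>L A t)) (at t)"
    and WU: "\<And>t. W t o\<^sub>L U t = id_blinfun" and UW: "\<And>t. U t o\<^sub>L W t = id_blinfun"
    using cauchy_pair_exists[OF A] by metis
  have "cauchy_op A = U"
    unfolding cauchy_op_def
  proof (rule the_equality)
    show "U 0 = id_blinfun \<and> (\<forall>x. is_solution A (\<lambda>_. 0) (\<lambda>t. blinfun_apply (U t) x))"
      using U0(1) has_vector_derivative_blinfun_apply[OF dU has_vector_derivative_const]
      by (simp add: is_solution_def)
    \<comment> \<open>Applying \<open>W t\<close> to a competing solution \<open>Z t x\<close> gives
      a constant, because the two terms of the product rule cancel; \<open>U t\<close> then recovers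
      the solution.\<close>
    fix Z assume Z: "Z 0 = id_blinfun \<and> (\<forall>x. is_solution A (\<lambda>_. 0) (\<lambda>t. blinfun_apply (Z t) x))"
    show "Z = U"
    proof (intro ext blinfun_eqI)
      fix t x
      have "((\<lambda>t. Z t x) has_vector_derivative A t (Z t x)) (at t)" for t
        using Z by (simp add: is_solution_def)
      note has_vector_derivative_blinfun_apply[OF dW this]
      then have "((\<lambda>t. W t (Z t x)) has_vector_derivative 0) (at t)" for t
        by (simp add: blinfun.bilinear_simps)
      then have "W t (Z t x) = W 0 (Z 0 x)"
        by (rule constant_of_zero_derivative)
      then have "U t (W t (Z t x)) = U t x" using Z U0 by simp
      then show "Z t x = U t x" using UW[of t] by (metis blinfun_apply_blinfun_compose blinfun_apply_id_blinfun)
    qed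
  qed
  moreover have "V = W"
    unfolding V_def \<open>cauchy_op A = U\<close> blinfun_inverse_def
  proof (intro ext the_equality)
    fix t S assume S: "S o\<^sub>L U t = id_blinfun \<and> U t o\<^sub>L S = id_blinfun"
    show "S = W t"
    proof (rule blinfun_eqI)
      fix x
      have "S (U t (W t x)) = W t x" "U t (W t x) = x"
        using S UW[of t] by (metis blinfun_apply_blinfun_compose blinfun_apply_id_blinfun)+
      then show "S x = W t x" by simp
    qed
  qed (use UW WU in auto)
  ultimately show "(cauchy_op A has_vector_derivative (A t o\<^sub>L cauchy_op A t)) (at t)"
    "(V has_vector_derivative - (V t o\<^sub>L A t)) (at t)"
    "cauchy_op A t (V t x) = x" "cauchy_op A 0 = id_blinfun"
    using dU dW UW[of t] U0(1) by (auto dest: arg_cong[where f = "\<lambda>T. blinfun_apply T x"])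
qed

section \<open>The solution given by the Green function\<close>

text \<open>Meant for the Green kernel, which jumps at \<open>0\<close> and at \<open>t\<close>: on
  either side of \<open>p\<close> the glued function agrees with one of the two pieces except at one
  point at most.\<close>

lemma integrable_on_If_less:
  fixes h1 h2 :: "real \<Rightarrow> 'a::banach"
  assumes "\<And>a b. h1 integrable_on {a..b}" "\<And>a b. h2 integrable_on {a..b}"
  shows "(\<lambda>s. if s < p then h1 s else h2 s) integrable_on {a..b}"
proof -
  let ?h = "\<lambda>s. if s < p then h1 s else h2 s"
  have left: "?h integrable_on {a..b}" if "b \<le> p" for a b
    by (rule integrable_spike_finite[of "{p}" _ _ h1]) (use that assms in auto)
  have right: "?h integrable_on {a..b}" if "p \<le> a" for a b
    by (rule integrable_spike_finite[of "{}" _ _ h2]) (use that assms in auto)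
  show ?thesis
  proof (cases "a \<le> p \<and> p \<le> b")
    case True
    then show ?thesis
      using Henstock_Kurzweil_Integration.integrable_combine[of a p b ?h] left[of p a] right[of p b]
      by auto
  next
    case False
    then show ?thesis using left[of b a] right[of a b] by linarith
  qed
qed

text \<open>Each half-line contributes \<open>1 / \<nu>\<close>. This is the integrable majorant of
  the Green kernel, with a mass independent of \<open>t\<close>, which makes the solution
  bounded.\<close>

lemma has_integral_exp_abs:
  fixes \<nu> t :: real
  assumes "0 < \<nu>"
  shows "((\<lambda>s. exp (- \<nu> * \<bar>t - s\<bar>)) has_integral 2 / \<nu>) UNIV"
proof -
  have R: "((\<lambda>s. exp (- \<nu> * \<bar>t - s\<bar>)) has_integral 1 / \<nu>) {t..}" for t
  proof -
    have "((\<lambda>s. exp (\<nu> * t) * exp (- \<nu> * s)) has_integral exp (\<nu> * t) * (exp (- \<nu> * t) / \<nu>)) {t..}"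
      by (rule has_integral_mult_right[OF has_integral_exp_minus_to_infinity[OF assms]])
    moreover have "exp (\<nu> * t) * (exp (- \<nu> * t) / \<nu>) = 1 / \<nu>"
      by (simp flip: exp_add)
    ultimately have "((\<lambda>s. exp (\<nu> * t) * exp (- \<nu> * s)) has_integral 1 / \<nu>) {t..}"
      by (simp only:)
    then show ?thesis
      by (rule has_integral_eq[rotated]) (auto simp: algebra_simps simp flip: exp_add)
  qed
  \<comment> \<open>With the kernel centred at \<open>- t\<close>, reflection carries the half-line
    right of \<open>- t\<close> to the one left of \<open>t\<close>; nonnegativity provides the
    absolute integrability.\<close>
  let ?g = "\<lambda>s. exp (- \<nu> * \<bar>- t - s\<bar>)"
  have "?g absolutely_integrable_on {- t..} \<and> integral {- t..} ?g = 1 / \<nu>"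
    using R[of "- t"] by (auto intro!: nonnegative_absolutely_integrable_1 simp: has_integral_iff)
  then have "(\<lambda>s. ?g (- s)) absolutely_integrable_on {..t} \<and> integral {..t} (\<lambda>s. ?g (- s)) = 1 / \<nu>"
    by (subst has_absolute_integral_reflect_real[where B = "{- t..}"]) auto
  then have "((\<lambda>s. ?g (- s)) has_integral 1 / \<nu>) {..t}"
    using set_lebesgue_integral_eq_integral(1) has_integral_iff by blast
  moreover have "\<bar>- t - - s\<bar> = \<bar>t - s\<bar>" for s by linarith
  ultimately have "((\<lambda>s. exp (- \<nu> * \<bar>t - s\<bar>)) has_integral 1 / \<nu>) {..t}" by simp
  then have "((\<lambda>s. exp (- \<nu> * \<bar>t - s\<bar>)) has_integral (1 / \<nu> + 1 / \<nu>)) ({..t} \<union> {t..})"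
    using R[of t] by (rule has_integral_Un) (simp flip: atLeastAtMost_def add: Int_commute)
  moreover have "{..t} \<union> {t..} = UNIV" by auto
  ultimately show ?thesis by simp
qed

lemma green_solution:
  fixes A :: "real \<Rightarrow> 'a::banach \<Rightarrow>\<^sub>L 'a"
  assumes A: "continuous_on UNIV A" and f: "continuous_on UNIV f"
    and M: "\<And>s. norm (f s) \<le> M" and "0 < \<nu>" and "0 \<le> N"
    and bd: "\<And>t s. norm (green A P Q t s) \<le> N * exp (- \<nu> * \<bar>t - s\<bar>)"
  obtains \<phi> where "is_solution A f \<phi>" "bounded (range \<phi>)"
    "\<And>t. has_abs_integral_line (\<lambda>s. green A P Q t s (f s)) (\<phi> t)"
proof -
  define U where "U = cauchy_op A"
  define V where "V = (\<lambda>t. blinfun_inverse (cauchy_op A t))"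
  have UV: "\<And>t. (U has_vector_derivative (A t o\<^sub>L U t)) (at t)"
    "\<And>t. (V has_vector_derivative - (V t o\<^sub>L A t)) (at t)"
    "\<And>t x. U t (V t x) = x" "U 0 = id_blinfun"
    using cauchy_pair[OF A] by (auto simp: U_def V_def)
  define F where "F = (\<lambda>s. V s (f s))"
  have V: "continuous_on UNIV V" by (rule continuous_on_UNIV_of_has_vector_derivative) (rule UV)
  have F: "continuous_on S F" for S
    unfolding F_def using V f by (intro continuous_intros) (auto intro: continuous_on_subset)
  define k where "k = (\<lambda>t s. green A P Q t s (f s))"
  \<comment> \<open>Sorted by increasing \<open>s\<close>, the cases of \<open>green\<close> have
    thresholds \<open>min 0 t\<close> and \<open>max 0 t\<close>, the nested form that
    \<open>integrable_on_If_less\<close> handles.\<close>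
  have k_cases: "k t s = (if s < min 0 t then U t (F s - Q (F s))
      else if s < max 0 t then (if 0 \<le> t then U t (P (F s)) else - U t (Q (F s)))
      else U t (P (F s) - F s))" for t s
    by (auto simp: k_def green_def conj_op_def F_def U_def V_def blinfun.bilinear_simps)
  have nk: "norm (k t s) \<le> N * M * exp (- \<nu> * \<bar>t - s\<bar>)" for t s
  proof -
    have "norm (k t s) \<le> norm (green A P Q t s) * norm (f s)" unfolding k_def by (rule norm_blinfun)
    also have "\<dots> \<le> (N * exp (- \<nu> * \<bar>t - s\<bar>)) * M"
      using bd M \<open>0 \<le> N\<close> by (intro mult_mono) auto
    finally show ?thesis by (simp add: mult_ac)
  qed
  have dom: "((\<lambda>s. N * M * exp (- \<nu> * \<bar>t - s\<bar>)) has_integral N * M * (2 / \<nu>)) UNIV" for t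
    by (rule has_integral_mult_right[OF has_integral_exp_abs[OF \<open>0 < \<nu>\<close>]])
  have ik: "k t integrable_on UNIV" for t
  proof (rule integrable_on_all_intervals_integrable_bound[OF _ nk])
    have "k t integrable_on {a..b}" for a b
      unfolding k_cases
      by (intro integrable_on_If_less; cases "0 \<le> t")
        (auto intro!: integrable_continuous_real continuous_intros F)
    then show "(\<lambda>s. if s \<in> UNIV then k t s else 0) integrable_on cbox a b" for a b by simp
  qed (use dom in blast)
  have ink: "(\<lambda>s. norm (k t s)) integrable_on UNIV" for t
  proof (rule integrable_on_all_intervals_integrable_bound)
    have "(\<lambda>s. norm (k t s)) integrable_on {a..b}" for a b
      unfolding k_cases if_distrib[of norm]
      by (intro integrable_on_If_less; cases "0 \<le> t")
        (auto intro!: integrable_continuous_real continuous_intros F)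
    then show "(\<lambda>s. if s \<in> UNIV then norm (k t s) else 0) integrable_on cbox a b" for a b by simp
  next
    show "norm (norm (k t s)) \<le> N * M * exp (- \<nu> * \<bar>t - s\<bar>)" for s using nk by simp
  qed (use dom in blast)
  \<comment> \<open>\<open>c\<close> is the value of the solution at \<open>0\<close>; the next line
    is the variation of constants formula with this initial value.\<close>
  define c where "c = integral UNIV (k 0)"
  define \<phi> where "\<phi> = (\<lambda>t. U t (c + primitive F t))"
  have int: "(k t has_integral \<phi> t) UNIV" for t
  proof -
    have Fi: "((\<lambda>s. if s \<in> {a..b} then F s else 0) has_integral integral {a..b} F) UNIV" for a b
      unfolding has_integral_restrict_UNIV
      by (intro integrable_integral integrable_continuous_real F)
    \<comment> \<open>Half-open intervals match the boundaries in \<open>k_cases\<close>, so that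
      \<open>U t (?r s) = k t s\<close> holds for every \<open>s\<close>; the omitted endpoint
      leaves the integrals unchanged.\<close>
    have 1: "((\<lambda>s. if s \<in> {0..<t} then F s else 0) has_integral integral {0..t} F) UNIV"
      by (rule has_integral_spike_finite[of "{t}", OF _ _ Fi]) auto
    have 2: "((\<lambda>s. if s \<in> {t..<0} then F s else 0) has_integral integral {t..0} F) UNIV"
      by (rule has_integral_spike_finite[of "{0}", OF _ _ Fi]) auto
    let ?r = "\<lambda>s. k 0 s + ((if s \<in> {0..<t} then F s else 0) - (if s \<in> {t..<0} then F s else 0))"
    have "(?r has_integral c + primitive F t) UNIV"
      unfolding primitive_def c_def by (intro has_integral_add has_integral_diff 1 2 integrable_integral ik)
    then have "((\<lambda>s. U t (?r s)) has_integral \<phi> t) UNIV"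
      unfolding \<phi>_def
      by (rule has_integral_linear[OF _ blinfun.bounded_linear_right, unfolded o_def])
    moreover have "U t (?r s) = k t s" for s
      by (auto simp: k_cases UV(4) blinfun.bilinear_simps)
    ultimately show ?thesis by simp
  qed
  have "is_solution A f \<phi>"
    unfolding is_solution_def
  proof
    fix t
    have "((\<lambda>t. c + primitive F t) has_vector_derivative F t) (at t)"
      using has_vector_derivative_add[OF has_vector_derivative_const has_vector_derivative_primitive[OF F]]
      by simp
    from has_vector_derivative_blinfun_apply[OF UV(1) this]
    show "(\<phi> has_vector_derivative A t (\<phi> t) + f t) (at t)"
      by (simp add: \<phi>_def F_def UV(3) add.commute)
  qed
  moreover have "bounded (range \<phi>)"
  proof (rule boundedI)
    fix x assume "x \<in> range \<phi>"
    then obtain t where "x = \<phi> t" by blast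
    then have "norm x = norm (integral UNIV (k t))" using int[of t] by (simp add: integral_unique)
    also have "\<dots> \<le> integral UNIV (\<lambda>s. N * M * exp (- \<nu> * \<bar>t - s\<bar>))"
      by (rule Henstock_Kurzweil_Integration.integral_norm_bound_integral[OF ik _ nk]) (use dom in blast)
    also have "\<dots> = N * M * (2 / \<nu>)" using dom by (rule integral_unique)
    finally show "norm x \<le> N * M * (2 / \<nu>)" .
  qed
  moreover have "has_abs_integral_line (\<lambda>s. green A P Q t s (f s)) (\<phi> t)" for t
    using int[of t] ink[of t] by (simp add: has_abs_integral_line_def k_def)
  ultimately show ?thesis using that by blast
qed

section \<open>Remote compatibility of bounded solutions\<close>

text \<open>The inverse Cauchy operator at \<open>s\<close> absorbs the homogeneous part of the
  equation, so only \<open>h\<close> survives; the remaining factor does not depend on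
  \<open>s\<close>.\<close>

lemma has_vector_derivative_conj_op:
  fixes A :: "real \<Rightarrow> 'a::banach \<Rightarrow>\<^sub>L 'a"
  assumes A: "continuous_on UNIV A" and y: "(y has_vector_derivative A s (y s) + h s) (at s)"
  shows "((\<lambda>s. conj_op A R t s (y s)) has_vector_derivative conj_op A R t s (h s)) (at s)"
proof -
  let ?V = "\<lambda>s. blinfun_inverse (cauchy_op A s)"
  have "((\<lambda>s. ?V s (y s)) has_vector_derivative ?V s (h s)) (at s)"
    using has_vector_derivative_blinfun_apply[OF cauchy_pair(2)[OF A] y]
    by (simp add: blinfun.bilinear_simps)
  then show ?thesis
    using bounded_linear.has_vector_derivative[OF blinfun.bounded_linear_right,
        of "\<lambda>s. ?V s (y s)" "?V s (h s)" _ "cauchy_op A t o\<^sub>L R"]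
    by (simp add: conj_op_def)
qed

text \<open>On a window of radius \<open>L\<close> that stays in one half-line the trichotomy is a dichotomy: the stable
  component is controlled by its value at the left end, the unstable one by that at the right end.\<close>

lemma dichotomy_window_bound:
  fixes A :: "real \<Rightarrow> 'a::banach \<Rightarrow>\<^sub>L 'a"
  assumes A: "continuous_on UNIV A"
    and y: "\<And>s. (y has_vector_derivative A s (y s) + h s) (at s)"
    and "0 < L" "0 < \<nu>" "0 \<le> N" and S: "{t - L..t + L} \<subseteq> S"
    and stable: "\<And>t s. t \<in> S \<Longrightarrow> s \<in> S \<Longrightarrow> s \<le> t \<Longrightarrow>
      norm (conj_op A R t s) \<le> N * exp (- \<nu> * (t - s))"
    and unstable: "\<And>t s. t \<in> S \<Longrightarrow> s \<in> S \<Longrightarrow> t \<le> s \<Longrightarrow>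
      norm (conj_op A (id_blinfun - R) t s) \<le> N * exp (- \<nu> * (s - t))"
    and Y: "\<And>s. norm (y s) \<le> Y"
    and H: "\<And>s. s \<in> {t - L..t + L} \<Longrightarrow> norm (h s) \<le> H"
  shows "norm (y t) \<le> 2 * N * Y * exp (- \<nu> * L) + 2 * N * H / \<nu>"
proof -
  define g where "g = (\<lambda>R s. conj_op A R t s (y s))"
  define g' where "g' = (\<lambda>R s. conj_op A R t s (h s))"
  have g': "(g R has_vector_derivative g' R s) (at s)" for R s
    unfolding g_def g'_def by (rule has_vector_derivative_conj_op[OF A y])
  have cont: "continuous_on T (g R)" for T R
    by (rule continuous_on_UNIV_of_has_vector_derivative[OF g'])
  have "H \<ge> 0" using order_trans[OF norm_ge_zero H[of t]] \<open>0 < L\<close> by simp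
  have bound: "norm (conj_op A R' t s z) \<le> N * e * B"
    if "norm (conj_op A R' t s) \<le> N * e" "norm z \<le> B" "0 \<le> e" for R' s e z B
    using norm_blinfun[of "conj_op A R' t s" z] mult_mono[OF that(1,2)] that \<open>0 \<le> N\<close> by simp
  \<comment> \<open>The mean value inequality compares \<open>g R\<close> with an explicit primitive
    of the bound on \<open>g' R\<close>, whose total increase is at most
    \<open>N * H / \<nu>\<close> for every \<open>L\<close>.\<close>
  have "norm (g R t - g R (t - L)) \<le>
      N * H / \<nu> * exp (- \<nu> * (t - t)) - N * H / \<nu> * exp (- \<nu> * (t - (t - L)))"
  proof (rule differentiable_bound_general[where \<phi> = "\<lambda>s. N * H / \<nu> * exp (- \<nu> * (t - s))"
        and f = "g R" and f' = "g' R" and \<phi>' = "\<lambda>s. N * exp (- \<nu> * (t - s)) * H"])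
    fix s assume "t - L < s" "s < t"
    then show "norm (g' R s) \<le> N * exp (- \<nu> * (t - s)) * H"
      unfolding g'_def using S \<open>0 < L\<close> by (intro bound stable H) auto
    show "((\<lambda>s. N * H / \<nu> * exp (- \<nu> * (t - s))) has_vector_derivative
        N * exp (- \<nu> * (t - s)) * H) (at s)"
      unfolding has_real_derivative_iff_has_vector_derivative[symmetric] using \<open>0 < \<nu>\<close>
      by (auto intro!: derivative_eq_intros)
  qed (use \<open>0 < L\<close> \<open>0 < \<nu>\<close> cont g' in \<open>auto intro!: continuous_intros\<close>)
  moreover have "N * H / \<nu> * exp (- \<nu> * L) \<ge> 0"
    using \<open>0 \<le> N\<close> \<open>0 \<le> H\<close> \<open>0 < \<nu>\<close> by simp
  ultimately have "norm (g R t - g R (t - L)) \<le> N * H / \<nu>" by simp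
  moreover have "norm (g R (t - L)) \<le> N * exp (- \<nu> * (t - (t - L))) * Y"
    unfolding g_def using S \<open>0 < L\<close> Y by (intro bound stable) auto
  ultimately have 1: "norm (g R t) \<le> N * H / \<nu> + N * exp (- \<nu> * L) * Y"
    using norm_triangle_sub[of "g R t" "g R (t - L)"] by simp
  let ?R = "id_blinfun - R"
  have "norm (g ?R (t + L) - g ?R t) \<le>
      - (N * H / \<nu> * exp (- \<nu> * (t + L - t))) - - (N * H / \<nu> * exp (- \<nu> * (t - t)))"
  proof (rule differentiable_bound_general[where \<phi> = "\<lambda>s. - (N * H / \<nu> * exp (- \<nu> * (s - t)))"
        and f = "g ?R" and f' = "g' ?R" and \<phi>' = "\<lambda>s. N * exp (- \<nu> * (s - t)) * H"])
    fix s assume "t < s" "s < t + L"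
    then show "norm (g' ?R s) \<le> N * exp (- \<nu> * (s - t)) * H"
      unfolding g'_def using S \<open>0 < L\<close> by (intro bound unstable H) auto
    show "((\<lambda>s. - (N * H / \<nu> * exp (- \<nu> * (s - t)))) has_vector_derivative
        N * exp (- \<nu> * (s - t)) * H) (at s)"
      unfolding has_real_derivative_iff_has_vector_derivative[symmetric] using \<open>0 < \<nu>\<close>
      by (auto intro!: derivative_eq_intros)
  qed (use \<open>0 < L\<close> \<open>0 < \<nu>\<close> cont g' in \<open>auto intro!: continuous_intros\<close>)
  moreover have "N * H / \<nu> * exp (- \<nu> * L) \<ge> 0"
    using \<open>0 \<le> N\<close> \<open>0 \<le> H\<close> \<open>0 < \<nu>\<close> by simp
  ultimately have "norm (g ?R t - g ?R (t + L)) \<le> N * H / \<nu>" by (simp add: norm_minus_commute)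
  moreover have "norm (g ?R (t + L)) \<le> N * exp (- \<nu> * (t + L - t)) * Y"
    unfolding g_def using S \<open>0 < L\<close> Y by (intro bound unstable) auto
  ultimately have 2: "norm (g ?R t) \<le> N * H / \<nu> + N * exp (- \<nu> * L) * Y"
    using norm_triangle_sub[of "g ?R t" "g ?R (t + L)"] by simp
  have "y t = g R t + g ?R t"
    using cauchy_pair(3)[OF A, of t] by (simp add: g_def conj_op_def blinfun.bilinear_simps)
  then have "norm (y t) \<le> norm (g R t) + norm (g ?R t)" by (simp add: norm_triangle_ineq)
  also have "\<dots> \<le> 2 * (N * H / \<nu> + N * exp (- \<nu> * L) * Y)" 
    using add_mono[OF 1 2] by (simp only: mult_2)
  also have "\<dots> = 2 * N * Y * exp (- \<nu> * L) + 2 * N * H / \<nu>" by (simp add: algebra_simps)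
  finally show ?thesis .
qed

section \<open>Convergence of translates\<close>

lemma continuous_on_shift:
  assumes "continuous_on UNIV g"
  shows "continuous_on S (shift a g)"
  unfolding shift_def
  by (rule continuous_on_compose2[OF assms]) (auto intro!: continuous_intros)

lemma is_solution_continuous_on:
  assumes "is_solution A f \<psi>"
  shows "continuous_on S \<psi>"
  using assms unfolding is_solution_def
  by (intro continuous_on_UNIV_of_has_vector_derivative) blast

text \<open>Completeness gives a limit that is uniform on each symmetric interval. Every point is
  interior to such an interval, whence continuity, and every compact set lies in one.\<close>

lemma shifts_converge_of_Cauchy:
  fixes g :: "real \<Rightarrow> 'e::complete_space"
  assumes g: "continuous_on UNIV g"
    and Cauchy: "\<And>K. uniformly_Cauchy_on {- K..K} (\<lambda>n. shift (t n) g)"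
  shows "shifts_converge g t"
proof -
  define l where "l = (\<lambda>s. lim (\<lambda>n. shift (t n) g s))"
  have lim: "uniform_limit {- K..K} (\<lambda>n. shift (t n) g) l sequentially" for K
    using Cauchy_uniformly_convergent[OF Cauchy]
    by (simp add: uniformly_convergent_uniform_limit_iff l_def)
  have "continuous (at s) l" for s
  proof -
    define K where "K = \<bar>s\<bar> + 1"
    have "continuous_on {- K..K} l"
      by (rule uniform_limit_theorem[OF _ lim])
        (auto intro!: always_eventually continuous_on_shift[OF g])
    moreover have "s \<in> interior {- K..K}" by (auto simp: K_def interior_atLeastAtMost_real)
    ultimately show ?thesis by (rule continuous_on_interior)
  qed
  then have "continuous_on UNIV l" by (simp add: continuous_at_imp_continuous_on)
  moreover have "uniform_limit K (\<lambda>n. shift (t n) g) l sequentially" if "compact K" for K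
  proof -
    obtain b where "\<forall>x\<in>K. norm x \<le> b"
      using compact_imp_bounded \<open>compact K\<close> by (force simp: bounded_iff)
    then have "K \<subseteq> {- b..b}" by force
    then show ?thesis using lim uniform_limit_on_subset by blast
  qed
  ultimately show ?thesis
    unfolding shifts_converge_def limitin_loc_unif_topology[OF continuous_on_shift[OF g]] by blast
qed

text \<open>\<open>S\<close> stands for either half-line and \<open>R\<close> for its stable
  projection, so that one argument serves both directions of time.\<close>

lemma shifts_converge_bounded_solution:
  fixes A :: "real \<Rightarrow> 'a::banach \<Rightarrow>\<^sub>L 'a"
  assumes A: "continuous_on UNIV A" and f: "continuous_on UNIV f"
    and \<psi>: "is_solution A f \<psi>" "bounded (range \<psi>)"
    and conv: "shifts_converge (\<lambda>t. (A t, f t)) \<tau>"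
    and "0 < \<nu>" "0 \<le> N"
    and S: "\<And>K. \<forall>\<^sub>F n in sequentially. {\<tau> n - K..\<tau> n + K} \<subseteq> S"
    and stable: "\<And>t s. t \<in> S \<Longrightarrow> s \<in> S \<Longrightarrow> s \<le> t \<Longrightarrow>
      norm (conj_op A R t s) \<le> N * exp (- \<nu> * (t - s))"
    and unstable: "\<And>t s. t \<in> S \<Longrightarrow> s \<in> S \<Longrightarrow> t \<le> s \<Longrightarrow>
      norm (conj_op A (id_blinfun - R) t s) \<le> N * exp (- \<nu> * (s - t))"
  shows "shifts_converge \<psi> \<tau>"
proof (rule shifts_converge_of_Cauchy)
  show "continuous_on UNIV \<psi>" using \<psi>(1) by (rule is_solution_continuous_on)
  obtain M where "0 < M" and M: "\<And>s. norm (\<psi> s) \<le> M"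
    using \<psi>(2) by (auto simp: bounded_pos)
  let ?Af = "\<lambda>t. (A t, f t)"
  have Af: "continuous_on UNIV ?Af" by (intro continuous_intros A f)
  have CAf: "uniformly_Cauchy_on {- K..K} (\<lambda>n. shift (\<tau> n) ?Af)" for K
    using conv unfolding shifts_converge_def limitin_loc_unif_topology[OF continuous_on_shift[OF Af]]
    by (meson compact_Icc uniformly_convergent_Cauchy uniformly_convergent_on_def)
  fix K :: real
  show "uniformly_Cauchy_on {- K..K} (\<lambda>n. shift (\<tau> n) \<psi>)"
  proof (rule uniformly_Cauchy_onI)
    fix e :: real assume "0 < e"
    \<comment> \<open>Chosen so that \<open>exp (\<nu> * L)\<close> exceeds
      \<open>8 * N * M / e\<close>, which pushes the endpoint term of the window bound below
      \<open>e / 2\<close>. The \<open>+ 1\<close> keeps the logarithm defined when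
      \<open>N = 0\<close>, and \<open>max 1\<close> keeps \<open>L\<close> positive.\<close>
    define L where "L = max 1 (ln (8 * N * M / e + 1) / \<nu>)"
    have "0 < L" by (simp add: L_def)
    have "ln (8 * N * M / e + 1) / \<nu> \<le> L" by (simp add: L_def)
    then have "ln (8 * N * M / e + 1) \<le> \<nu> * L"
      using \<open>0 < \<nu>\<close> by (simp add: field_simps)
    moreover have pos: "0 < 8 * N * M / e + 1"
      using \<open>0 \<le> N\<close> \<open>0 < M\<close> \<open>0 < e\<close> by (simp add: add_nonneg_pos)
    ultimately have "8 * N * M / e + 1 \<le> exp (\<nu> * L)" 
      by (metis exp_le_cancel_iff exp_ln)
    then have "8 * N * M / e < exp (\<nu> * L)" by linarith
    then have small: "2 * N * (2 * M) * exp (- \<nu> * L) < e / 2"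
      using \<open>0 < e\<close> by (simp add: exp_minus field_simps)
    \<comment> \<open>The inhomogeneity will be at most \<open>\<delta> * (M + 1)\<close>:
      \<open>\<delta> * M\<close> from the change of \<open>A\<close> acting on the solution and
      \<open>\<delta>\<close> from that of \<open>f\<close>. Its share of the window bound is then
      at most \<open>e / 2\<close>.\<close>
    define \<delta> where "\<delta> = e * \<nu> / (4 * (N + 1) * (M + 1))"
    have "0 < \<delta>" using \<open>0 < e\<close> \<open>0 < \<nu>\<close> \<open>0 \<le> N\<close> \<open>0 < M\<close> by (simp add: \<delta>_def)
    have "2 * N * (\<delta> * (M + 1)) / \<nu> = N / (N + 1) * (e / 2)"
      using \<open>0 < \<nu>\<close> \<open>0 \<le> N\<close> \<open>0 < M\<close> by (simp add: \<delta>_def divide_simps)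
    also have "\<dots> \<le> 1 * (e / 2)"
      using \<open>0 \<le> N\<close> \<open>0 < e\<close> by (intro mult_right_mono) auto
    finally have small': "2 * N * (\<delta> * (M + 1)) / \<nu> \<le> e / 2" by simp
    \<comment> \<open>A window of radius \<open>L\<close> around a point of \<open>{- K..K}\<close>
      reaches out to \<open>K + L\<close>.\<close>
    obtain n1 where n1: "\<And>\<sigma> m n. \<sigma> \<in> {- (K + L)..K + L} \<Longrightarrow> n1 \<le> m \<Longrightarrow> n1 \<le> n \<Longrightarrow>
        dist (shift (\<tau> m) ?Af \<sigma>) (shift (\<tau> n) ?Af \<sigma>) < \<delta>"
      using CAf[of "K + L"] \<open>0 < \<delta>\<close> unfolding uniformly_Cauchy_on_def by meson
    obtain n2 where n2: "\<And>n. n2 \<le> n \<Longrightarrow> {\<tau> n - (K + L)..\<tau> n + (K + L)} \<subseteq> S"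
      using S[of "K + L"] unfolding eventually_sequentially by blast
    have "dist (shift (\<tau> m) \<psi> x) (shift (\<tau> n) \<psi> x) < e"
      if x: "x \<in> {- K..K}" and m: "max n1 n2 \<le> m" and n: "max n1 n2 \<le> n" for x m n
    proof -
      define d where "d = \<tau> m - \<tau> n"
      define y where "y = (\<lambda>s. \<psi> s - \<psi> (s + d))"
      \<comment> \<open>The coefficient \<open>A s\<close> is kept for the difference, so the
        trichotomy of the original equation applies to it; the change of \<open>A\<close> under the
        shift goes into \<open>h\<close>.\<close>
      define h where "h = (\<lambda>s. (A s - A (s + d)) (\<psi> (s + d)) + (f s - f (s + d)))"
      let ?t = "x + \<tau> n"
      have "(y has_vector_derivative A s (y s) + h s) (at s)" for s
      proof -
        have "((\<lambda>s. s + d) has_vector_derivative 1) (at s)" by (auto intro!: derivative_eq_intros)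
        moreover have "(\<psi> has_vector_derivative A (s + d) (\<psi> (s + d)) + f (s + d)) (at (s + d))"
          using \<psi>(1) by (simp add: is_solution_def)
        ultimately have "((\<lambda>s. \<psi> (s + d)) has_vector_derivative
            1 *\<^sub>R (A (s + d) (\<psi> (s + d)) + f (s + d))) (at s)"
          by (rule vector_diff_chain_at[unfolded o_def])
        moreover have "(\<psi> has_vector_derivative A s (\<psi> s) + f s) (at s)"
          using \<psi>(1) by (simp add: is_solution_def)
        ultimately show ?thesis
          unfolding y_def
          by (rule has_vector_derivative_eq_rhs[OF has_vector_derivative_diff[rotated]])
            (simp add: h_def blinfun.bilinear_simps)
      qed
      moreover have "{?t - L..?t + L} \<subseteq> S"
        using n2[of n] n x by force
      moreover have "norm (y s) \<le> 2 * M" for s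
        unfolding y_def using norm_triangle_ineq4[of "\<psi> s" "\<psi> (s + d)"] M[of s] M[of "s + d"]
        by linarith
      moreover have "norm (h s) \<le> \<delta> * (M + 1)" if s: "s \<in> {?t - L..?t + L}" for s
      proof -
        have "dist (shift (\<tau> n) ?Af (s - \<tau> n)) (shift (\<tau> m) ?Af (s - \<tau> n)) < \<delta>"
          using s x m n by (intro n1) auto
        moreover have "s - \<tau> n + \<tau> m = s + d" by (simp add: d_def)
        ultimately have *: "dist (A s, f s) (A (s + d), f (s + d)) < \<delta>"
          by (simp add: shift_def)
        then have "norm (A s - A (s + d)) \<le> \<delta>" "norm (f s - f (s + d)) \<le> \<delta>"
          using dist_fst_le[of "(A s, f s)" "(A (s + d), f (s + d))"]
            dist_snd_le[of "(A s, f s)" "(A (s + d), f (s + d))"] by (simp_all add: dist_norm)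
        moreover from this(1) have "norm ((A s - A (s + d)) (\<psi> (s + d))) \<le> \<delta> * M"
          using norm_blinfun[of "A s - A (s + d)" "\<psi> (s + d)"] M[of "s + d"] \<open>0 < \<delta>\<close>
          by (meson less_imp_le mult_mono norm_ge_zero order_trans)
        ultimately show ?thesis
          unfolding h_def by (intro norm_triangle_le) (simp add: algebra_simps)
      qed
      ultimately have "norm (y ?t) \<le> 2 * N * (2 * M) * exp (- \<nu> * L) + 2 * N * (\<delta> * (M + 1)) / \<nu>"
        by (intro dichotomy_window_bound[OF A _ \<open>0 < L\<close> \<open>0 < \<nu>\<close> \<open>0 \<le> N\<close> _ stable unstable])
      also have "\<dots> < e" using small small' by simp
      finally show ?thesis
        by (simp add: y_def d_def shift_def dist_norm norm_minus_commute algebra_simps)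
    qed
    then show "\<exists>k. \<forall>x\<in>{- K..K}. \<forall>m\<ge>k. \<forall>n\<ge>k. dist (shift (\<tau> m) \<psi> x) (shift (\<tau> n) \<psi> x) < e"
      by blast
  qed
qed

text \<open>Evaluation at \<open>0\<close> is continuous, so it sends the compact closure of the
  translates to a compact set, and the value at \<open>0\<close> of the translate by
  \<open>h\<close> is \<open>g h\<close>.\<close>

lemma lagrange_stable_imp_bounded:
  fixes g :: "real \<Rightarrow> 'e::metric_space"
  assumes "lagrange_stable g"
  shows "bounded (range g)"
proof -
  have g: "continuous_on UNIV g"
    and cpt: "compactin loc_unif_topology (loc_unif_topology closure_of (range (\<lambda>h. shift h g)))"
    using assms by (auto simp: lagrange_stable_def)
  have "continuous_map loc_unif_topology euclidean (\<lambda>h :: real \<Rightarrow> 'e. h 0)"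
    unfolding continuous_map_def
  proof (intro conjI allI impI)
    fix W :: "'e set" assume W: "openin euclidean W"
    show "openin loc_unif_topology {h \<in> topspace loc_unif_topology. h 0 \<in> W}"
      unfolding openin_loc_unif_topology topspace_loc_unif_topology
    proof (intro conjI ballI)
      fix h assume "h \<in> {h \<in> {g. continuous_on UNIV g}. h 0 \<in> W}"
      then obtain e where "0 < e" "ball (h 0) e \<subseteq> W"
        using W by (auto simp: open_contains_ball)
      then show "\<exists>K \<epsilon>. compact K \<and> 0 < \<epsilon> \<and>
          {k. continuous_on UNIV k \<and> (\<forall>t\<in>K. dist (k t) (h t) < \<epsilon>)} \<subseteq>
          {h \<in> {g. continuous_on UNIV g}. h 0 \<in> W}"
        by (intro exI[of _ "{0}"] exI[of _ e]) (auto simp: dist_commute subset_iff)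
    qed auto
  qed auto
  from image_compactin[OF cpt this]
  have "bounded ((\<lambda>h. h 0) ` (loc_unif_topology closure_of (range (\<lambda>h. shift h g))))"
    by (simp add: compact_imp_bounded)
  moreover have "range (\<lambda>h. shift h g) \<subseteq> loc_unif_topology closure_of (range (\<lambda>h. shift h g))"
    using continuous_on_shift[OF g]
    by (intro closure_of_subset) (auto simp: topspace_loc_unif_topology)
  then have "(\<lambda>h. h 0) ` range (\<lambda>h. shift h g) \<subseteq>
      (\<lambda>h. h 0) ` (loc_unif_topology closure_of (range (\<lambda>h. shift h g)))"
    by (rule image_mono)
  then have "range g \<subseteq> (\<lambda>h. h 0) ` (loc_unif_topology closure_of (range (\<lambda>h. shift h g)))"
    by (simp add: shift_def image_image)
  ultimately show ?thesis by (rule bounded_subset)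
qed

theorem theorem5p7:
  fixes A :: "real \<Rightarrow> 'a::banach \<Rightarrow>\<^sub>L 'a" and f :: "real \<Rightarrow> 'a"
    and P Q :: "'a \<Rightarrow>\<^sub>L 'a"
  assumes "continuous_on UNIV A" and "continuous_on UNIV f"
    and "lagrange_stable (\<lambda>t. (A t, f t))"
    and "exponential_trichotomy A P Q"
  shows "(\<exists>\<phi>. is_solution A f \<phi> \<and> two_sided_remotely_compatible A f \<phi> \<and>
            (\<forall>t. has_abs_integral_line (\<lambda>\<tau>. blinfun_apply (green A P Q t \<tau>) (f \<tau>)) (\<phi> t))) \<and>
         (\<forall>\<psi>. is_solution A f \<psi> \<and> bounded (range \<psi>) \<longrightarrow>
            two_sided_remotely_compatible A f \<psi>)"
proof -
  obtain N \<nu> where "1 \<le> N" "0 < \<nu>"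
    and P: "\<And>t s. 0 \<le> s \<Longrightarrow> s \<le> t \<Longrightarrow> norm (conj_op A P t s) \<le> N * exp (- \<nu> * (t - s))"
    and IP: "\<And>t s. t \<le> s \<Longrightarrow> 0 \<le> s \<Longrightarrow>
      norm (conj_op A (id_blinfun - P) t s) \<le> N * exp (- \<nu> * (s - t))"
    and Q: "\<And>t s. t \<le> s \<Longrightarrow> s \<le> 0 \<Longrightarrow> norm (conj_op A Q t s) \<le> N * exp (- \<nu> * (s - t))"
    and IQ: "\<And>t s. s \<le> t \<Longrightarrow> s \<le> 0 \<Longrightarrow>
      norm (conj_op A (id_blinfun - Q) t s) \<le> N * exp (- \<nu> * (t - s))"
    using assms(4) unfolding exponential_trichotomy_def by (elim conjE exE) (rule that, assumption, assumption, blast+)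
  have "0 \<le> N" using \<open>1 \<le> N\<close> by simp
  have "bounded (snd ` range (\<lambda>t. (A t, f t)))"
    using lagrange_stable_imp_bounded[OF assms(3)] by (rule bounded_snd)
  then obtain M where M: "\<And>s. norm (f s) \<le> M" by (auto simp: bounded_iff)
  have compatible: "two_sided_remotely_compatible A f \<psi>"
    if \<psi>: "is_solution A f \<psi>" "bounded (range \<psi>)" for \<psi>
    unfolding two_sided_remotely_compatible_def
  proof
    fix \<tau> assume "\<tau> \<in> L_inf (\<lambda>t. (A t, f t))"
    then consider
      (plus) "filterlim \<tau> at_top sequentially" "shifts_converge (\<lambda>t. (A t, f t)) \<tau>"
      | (minus) "filterlim \<tau> at_bot sequentially" "shifts_converge (\<lambda>t. (A t, f t)) \<tau>"
      by (auto simp: L_inf_def L_plus_inf_def L_minus_inf_def)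
    then show "\<tau> \<in> L_inf \<psi>"
    proof cases
      case plus
      have "\<forall>\<^sub>F n in sequentially. {\<tau> n - K..\<tau> n + K} \<subseteq> {0..}" for K
        using plus(1)[unfolded filterlim_at_top, rule_format, of K] by (rule eventually_mono) auto
      then have "shifts_converge \<psi> \<tau>"
        using P IP
        by (intro shifts_converge_bounded_solution[OF assms(1,2) \<psi> plus(2) \<open>0 < \<nu>\<close> \<open>0 \<le> N\<close>,
              where S = "{0..}" and R = P]) auto
      with plus show ?thesis by (simp add: L_inf_def L_plus_inf_def)
    next
      case minus
      have "\<forall>\<^sub>F n in sequentially. {\<tau> n - K..\<tau> n + K} \<subseteq> {..0}" for K
        using minus(1)[unfolded filterlim_at_bot, rule_format, of "- K"] by (rule eventually_mono) auto
      \<comment> \<open>On the negative half-line the stable component is that of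
        \<open>id_blinfun - Q\<close>, and its complement is \<open>Q\<close>.\<close>
      then have "shifts_converge \<psi> \<tau>"
        using Q IQ
        by (intro shifts_converge_bounded_solution[OF assms(1,2) \<psi> minus(2) \<open>0 < \<nu>\<close> \<open>0 \<le> N\<close>,
              where S = "{..0}" and R = "id_blinfun - Q"]) auto
      with minus show ?thesis by (simp add: L_inf_def L_minus_inf_def)
    qed
  qed
  have "norm (green A P Q t s) \<le> N * exp (- \<nu> * \<bar>t - s\<bar>)" for t s
  proof -
    \<comment> \<open>A disjoint form of the four cases; \<open>s = 0\<close> goes to the first two,
      as the order of the tests in \<open>green\<close> prescribes.\<close>
    consider "0 \<le> s" "s < t" | "0 \<le> s" "t \<le> s" | "s < 0" "t \<le> s" | "s < 0" "s < t" by linarith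
    then show ?thesis
      by cases (use P[of s t] IP[of t s] Q[of t s] IQ[of s t] in \<open>simp_all add: green_def\<close>)
  qed
  then obtain \<phi> where "is_solution A f \<phi>" "bounded (range \<phi>)"
    "\<And>t. has_abs_integral_line (\<lambda>s. green A P Q t s (f s)) (\<phi> t)"
    using green_solution[OF assms(1,2) M \<open>0 < \<nu>\<close> \<open>0 \<le> N\<close>] by blast
  \<comment> \<open>Since \<open>\<phi>\<close> is bounded, its compatibility is the case
    \<open>\<psi> = \<phi>\<close> of the claim on bounded solutions.\<close>
  with compatible show ?thesis by blast
qed

end
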